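(* Assume that $2s\le d$, $s,d\to\infty$ and $\delta$ and $\alpha$ are fixed. Let $\alpha'=\gamma\alpha$ for any constant $0<\gamma<1$. Suppose that $s,a$ satisfy $$\frac a\sigma\ge\sqrt{2\log(d-s)-\log\log(d-s)+C'}+\Big\{\sqrt{2\log s-\log\log s+C'}\ \vee\ \bar\xi_d\Big\}$$ for some sufficiently large positive constant $C'$ and $\bar\xi_d=\sqrt{(2\log\log(d-s)-\log\log s)_+}$. Then the adaptive sparse confidence set $\hat M^{ad}_{\alpha'}$ belongs to $\mathcal M_+$ and $$\limsup_{d,s\to\infty}\frac{R(\hat M^{ad}_{\alpha'},\Theta^+(s,a))}{\sigma\sqrt{2\log s}}\le1 .$$
   Context: $X=(X_1,\dots,X_d)\sim N(\theta,\sigma^2 I_d)$ with $\theta\in\mathbb R^d$ unknown and $\sigma$ known; $\mathbb P_\theta,\mathbb E_\theta$ are the corresponding probability and expectation. The levels satisfy $0<\alpha<1$ and $0<\delta<1$. $x\vee y=\max(x,y)$, $(x)_+=\max(x,0)$, $[d]=\{1,\dots,d\}$, $\|\theta\|_0=|\{j:\theta_j\neq0\}|$. The parameter space is $\Theta^+(s,a)=\{\theta\in\mathbb R^d:\|\theta\|_0\le s,\ \min_{j:\theta_j\neq0}\theta_j\ge a\}$ for some $s,a>0$. In asymptotic statements $a/\sigma$ may vary with $(d,s)$. For a random subset $S=S(X)\subseteq[d]$ and bounds $L_j=L_j(X)$, $U_j=U_j(X)$, $$M(S,U,L)=\{\theta\in\mathbb R^d:\ \theta_j=0\text{ for all }j\in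 S^c,\ \theta_j\in[L_j,U_j]\text{ for all }j\in S\}.$$ $CI_+$ is the class of all $M(S,U,L)$ such that for every $j\in[d]$: $L_j,U_j$ depend only on $X_j$; $0\le L_j\le X_j\vee0$ and $U_j=+\infty$ if $j\in S$; otherwise $L_j=U_j=0$. $\mathcal F(\delta)$ is the class of random subsets $S=S(X)\subseteq[d]$ such that for every $j\in[d]$: the event $\{j\in S(X)\}$ depends only on $X_j$, and $\mathbb P_0(j\in S(X))\le1-\delta$, where $\mathbb P_0$ is the probability when $X_j\sim N(0,\sigma^2)$. The criterion is $$R(M(S,U,L),\Theta^+(s,a))=\sup_{1\le j\le d}\sup_{\theta\in\Theta^+(s,a)}\mathbb E_\theta(\theta_j-L_j).$$ The class $\mathcal M_+$ is $$\mathcal M_+=\Big\{M(S,U,L)\in CI_+:\ \liminf_{d,s\to\infty}\inf_{\theta\in\Theta^+(s,a)}\mathbb P_\theta(\theta\in M(S,U,L))\ge1-\alpha,\ \text{and } S\in\mathcal F(\delta)\Big\}.$$ Put $C_{x,\beta}=2\sqrt{\pi\log(x/\beta)}$ and $$\bar S^{ad}_{\alpha'}=\Big\{j\in[d]:\ X_j/\sigma\ge\sqrt{2\log\Big(\frac{2d}{(\alpha-\alpha')C_{d,\alpha-\alpha'}}\Big)}\Big\}.$$ Consider the grid $\{1,2,2^2,\dots,2^T\}$, where $T$ is the largest integer such that $2^T\le d$. Let $\hat s=2^{\hat m}$, where $\hat m$ is the $m\in[T]=\{1,\dots,T\}$ with $2^{m-1}\le|\bar S^{ad}_{\alpha'}|<2^{m}$.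 The adaptive sparse confidence set is $\hat M^{ad}_{\alpha'}=M(\bar S^{ad}_{\alpha'},\hat U,\hat L_{\hat s})$, where $\hat L_{j,\hat s}=(X_j-u_{\alpha',\hat s}\sigma)_+$, $\hat U_j=+\infty$ for $j\in\bar S^{ad}_{\alpha'}$ and $\hat L_{j,\hat s}=\hat U_j=0$ otherwise, with $$u_{\alpha',\hat s}=\sqrt{2\log\Big(\frac{4\hat s}{(\alpha-\alpha')C_{2\hat s,\alpha-\alpha'}}\Big)}.$$
   Formalization: In the class M_+, "L_j, U_j depend only on X_j" is read as holding once the value of ŝ is given, since the adaptive L_j depends on all coordinates through ŝ; the requirements at fixed (d,s), such as S in F(δ), are imposed for all large d,s. *)

theory Defs
  imports "HOL-Probability.Probability"
begin

text \<open>
  Vectors of \<open>\<real>\<^sup>d\<close> are extensional functions on the coordinate set \<open>[d] = {1..d}\<close>, so that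
  \<open>d\<close> can tend to infinity.
\<close>

type_synonym vec = "nat \<Rightarrow> real"

definition Rd :: "nat \<Rightarrow> vec set" where
  "Rd d = {1..d} \<rightarrow>\<^sub>E UNIV"

definition gauss :: "nat \<Rightarrow> real \<Rightarrow> vec \<Rightarrow> vec measure" where
  "gauss d \<sigma> \<theta> = Pi\<^sub>M {1..d} (\<lambda>j. density lborel (normal_density (\<theta> j) \<sigma>))"

definition nnz :: "nat \<Rightarrow> vec \<Rightarrow> nat" where
  "nnz d \<theta> = card {j\<in>{1..d}. \<theta> j \<noteq> 0}"

text \<open>The minimum over an empty support is \<open>+\<infinity>\<close>, so the zero vector belongs to the class.\<close>

definition Theta_plus :: "nat \<Rightarrow> nat \<Rightarrow> real \<Rightarrow> vec set" where
  "Theta_plus d s a = {\<theta>\<in>Rd d. nnz d \<theta> \<le> s \<and> (\<forall>j\<in>{1..d}. \<theta> j \<noteq> 0 \<longrightarrow> a \<le> \<theta> j)}"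

text \<open>
  A random set \<open>M(S,U,L)\<close> is handled through its three ingredients, each a function of the
  data. Upper bounds are extended reals because \<open>U\<^sub>j = +\<infinity>\<close> is used.
\<close>

type_synonym sel = "vec \<Rightarrow> nat set"
type_synonym upper = "vec \<Rightarrow> nat \<Rightarrow> ereal"
type_synonym lower = "vec \<Rightarrow> nat \<Rightarrow> real"

definition conf_set :: "nat \<Rightarrow> sel \<Rightarrow> upper \<Rightarrow> lower \<Rightarrow> vec \<Rightarrow> vec set" where
  "conf_set d S U L X =
     {\<theta>\<in>Rd d. (\<forall>j\<in>{1..d} - S X. \<theta> j = 0) \<and>
              (\<forall>j\<in>S X. ereal (L X j) \<le> ereal (\<theta> j) \<and> ereal (\<theta> j) \<le> U X j)}"

definition depends_only_on :: "nat \<Rightarrow> nat \<Rightarrow> (vec \<Rightarrow> 'b::topological_space) \<Rightarrow> bool" where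
  "depends_only_on d j f \<longleftrightarrow> (\<exists>g\<in>borel_measurable borel. \<forall>X\<in>Rd d. f X = g (X j))"

definition CI_plus :: "nat \<Rightarrow> (sel \<times> upper \<times> lower) set" where
  "CI_plus d = {(S, U, L).
     (\<forall>X\<in>Rd d. S X \<subseteq> {1..d}) \<and>
     (\<forall>j\<in>{1..d}.
        depends_only_on d j (\<lambda>X. L X j) \<and> depends_only_on d j (\<lambda>X. U X j) \<and>
        (\<forall>X\<in>Rd d. if j \<in> S X then 0 \<le> L X j \<and> L X j \<le> max (X j) 0 \<and> U X j = \<infinity>
                   else L X j = 0 \<and> U X j = 0))}"

text \<open>
  Bounds that involve a data-driven tuning parameter \<open>\<tau>(X)\<close> (such as an estimated sparsity)
  depend on \<open>X\<^sub>j\<close> only once the value of the tuning parameter is given. Such a procedure is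
  admitted if it is a \<open>\<tau>(X)\<close>-selection from genuine members of \<open>CI_plus d\<close> that share the same
  selector \<open>S\<close>. For a constant \<open>\<tau>\<close> this is exactly the class above.
\<close>

definition CI_plus_tuned :: "nat \<Rightarrow> (vec \<Rightarrow> nat) \<Rightarrow> (sel \<times> upper \<times> lower) set" where
  "CI_plus_tuned d \<tau> = {(S, U, L).
     (\<forall>t. {X\<in>Rd d. \<tau> X = t} \<in> sets (Pi\<^sub>M {1..d} (\<lambda>_. borel))) \<and>
     (\<exists>U' L'. (\<forall>t\<in>\<tau> ` Rd d. (S, U' t, L' t) \<in> CI_plus d) \<and>
              (\<forall>X\<in>Rd d. \<forall>j\<in>{1..d}. U X j = U' (\<tau> X) X j \<and> L X j = L' (\<tau> X) X j))}"

lemma CI_plus_cong: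
  assumes "(S, U, L) \<in> CI_plus d"
    and eq: "\<forall>X\<in>Rd d. \<forall>j\<in>{1..d}. U' X j = U X j \<and> L' X j = L X j"
  shows "(S, U', L') \<in> CI_plus d"
proof -
  show ?thesis
    unfolding CI_plus_def mem_Collect_eq prod.case
  proof (intro conjI ballI)
    show "S X \<subseteq> {1..d}" if "X \<in> Rd d" for X
      using assms(1) that unfolding CI_plus_def by blast
  next
    fix j assume j: "j \<in> {1..d}"
    show "depends_only_on d j (\<lambda>X. L' X j)" "depends_only_on d j (\<lambda>X. U' X j)"
      using assms(1) j eq unfolding CI_plus_def depends_only_on_def by fastforce+
    fix X assume X: "X \<in> Rd d"
    show "if j \<in> S X then 0 \<le> L' X j \<and> L' X j \<le> max (X j) 0 \<and> U' X j = \<infinity>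
          else L' X j = 0 \<and> U' X j = 0"
      using assms(1) j X eq unfolding CI_plus_def by auto
  qed
qed

lemma CI_plus_tuned_const: "CI_plus_tuned d (\<lambda>_. t) = CI_plus d"
proof -
  have ne: "(\<lambda>_. t) ` Rd d = {t}"
    by (auto simp: Rd_def PiE_eq_empty_iff)
  have sp: "Rd d = space (Pi\<^sub>M {1..d} (\<lambda>_. borel))"
    by (simp add: Rd_def space_PiM)
  have meas: "{X\<in>Rd d. t = t'} \<in> sets (Pi\<^sub>M {1..d} (\<lambda>_. borel))" for t'
    unfolding sp by (cases "t = t'") simp_all
  have "(S, U, L) \<in> CI_plus_tuned d (\<lambda>_. t) \<longleftrightarrow> (S, U, L) \<in> CI_plus d" for S U L
  proof
    assume "(S, U, L) \<in> CI_plus_tuned d (\<lambda>_. t)"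
    then obtain U' L' where *: "(S, U' t, L' t) \<in> CI_plus d"
      and **: "\<forall>X\<in>Rd d. \<forall>j\<in>{1..d}. U X j = U' t X j \<and> L X j = L' t X j"
      unfolding CI_plus_tuned_def ne by blast
    show "(S, U, L) \<in> CI_plus d"
      by (rule CI_plus_cong[OF * **])
  next
    assume *: "(S, U, L) \<in> CI_plus d"
    show "(S, U, L) \<in> CI_plus_tuned d (\<lambda>_. t)"
      unfolding CI_plus_tuned_def mem_Collect_eq prod.case ne
      by (intro conjI allI meas exI[of _ "\<lambda>_. U"] exI[of _ "\<lambda>_. L"]) (use * in blast)+
  qed
  then show ?thesis by auto
qed

definition selectors :: "nat \<Rightarrow> real \<Rightarrow> real \<Rightarrow> sel set" where
  "selectors d \<sigma> \<delta> = {S.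
     (\<forall>X\<in>Rd d. S X \<subseteq> {1..d}) \<and>
     (\<forall>j\<in>{1..d}. \<exists>A\<in>sets borel.
        (\<forall>X\<in>Rd d. j \<in> S X \<longleftrightarrow> X j \<in> A) \<and>
        measure (density lborel (normal_density 0 \<sigma>)) A \<le> 1 - \<delta>)}"

definition risk :: "nat \<Rightarrow> real \<Rightarrow> lower \<Rightarrow> vec set \<Rightarrow> ereal" where
  "risk d \<sigma> L \<Theta> = (SUP j\<in>{1..d}. SUP \<theta>\<in>\<Theta>. ereal (\<integral>X. \<theta> j - L X j \<partial>gauss d \<sigma> \<theta>))"

text \<open>The joint limit \<open>d, s \<longrightarrow> \<infinity>\<close> under the standing restriction \<open>2s \<le> d\<close>; pairs are \<open>(d, s)\<close>.\<close>

definition regime :: "(nat \<times> nat) filter" where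
  "regime = inf (at_top \<times>\<^sub>F at_top) (principal {(d, s). 2 * s \<le> d})"

text \<open>
  All objects are families indexed by \<open>(d, s)\<close>. As the class is asymptotic, the requirements
  at fixed \<open>(d, s)\<close> are imposed eventually: for \<open>\<delta>\<close> close to \<open>1\<close>, a threshold selector of fixed
  form satisfies its constraint only once \<open>d\<close> is large.
\<close>

definition M_plus_tuned ::
  "real \<Rightarrow> real \<Rightarrow> (nat \<Rightarrow> nat \<Rightarrow> real) \<Rightarrow> (nat \<Rightarrow> nat \<Rightarrow> real) \<Rightarrow> (nat \<Rightarrow> nat \<Rightarrow> vec \<Rightarrow> nat) \<Rightarrow>
   ((nat \<Rightarrow> nat \<Rightarrow> sel) \<times> (nat \<Rightarrow> nat \<Rightarrow> upper) \<times> (nat \<Rightarrow> nat \<Rightarrow> lower)) set" where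
  "M_plus_tuned \<alpha> \<delta> \<sigma> a \<tau> = {(S, U, L).
     (\<forall>\<^sub>F (d, s) in regime. (S d s, U d s, L d s) \<in> CI_plus_tuned d (\<tau> d s)) \<and>
     Liminf regime (\<lambda>(d, s). INF \<theta>\<in>Theta_plus d s (a d s).
         ereal (measure (gauss d (\<sigma> d s) \<theta>)
           {X\<in>Rd d. \<theta> \<in> conf_set d (S d s) (U d s) (L d s) X})) \<ge> ereal (1 - \<alpha>) \<and>
     (\<forall>\<^sub>F (d, s) in regime. S d s \<in> selectors d (\<sigma> d s) \<delta>)}"

abbreviation M_plus where
  "M_plus \<alpha> \<delta> \<sigma> a \<equiv> M_plus_tuned \<alpha> \<delta> \<sigma> a (\<lambda>_ _ _. 0)"

definition Cfun :: "real \<Rightarrow> real \<Rightarrow> real" where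
  "Cfun x \<beta> = 2 * sqrt (pi * ln (x / \<beta>))"

definition S_ad :: "real \<Rightarrow> real \<Rightarrow> nat \<Rightarrow> real \<Rightarrow> sel" where
  "S_ad \<alpha> \<alpha>' d \<sigma> X =
     {j\<in>{1..d}. X j / \<sigma> \<ge> sqrt (2 * ln (2 * real d / ((\<alpha> - \<alpha>') * Cfun (real d) (\<alpha> - \<alpha>'))))}"

definition grid_top :: "nat \<Rightarrow> nat" where
  "grid_top d = (GREATEST t. 2 ^ t \<le> d)"

text \<open>
  The defining condition of \<open>m\<close> has no solution in \<open>[T]\<close> when the selected set is empty (then all
  bounds are zero and \<open>m\<close> is irrelevant) or has at least \<open>2\<^sup>T\<close> elements; the top of the grid is
  used there.
\<close>

definition m_hat :: "real \<Rightarrow> real \<Rightarrow> nat \<Rightarrow> real \<Rightarrow> vec \<Rightarrow> nat" where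
  "m_hat \<alpha> \<alpha>' d \<sigma> X =
     (let P = (\<lambda>m. m \<in> {1..grid_top d} \<and>
                   2 ^ (m - 1) \<le> card (S_ad \<alpha> \<alpha>' d \<sigma> X) \<and> card (S_ad \<alpha> \<alpha>' d \<sigma> X) < 2 ^ m)
      in if \<exists>m. P m then THE m. P m else grid_top d)"

definition s_hat :: "real \<Rightarrow> real \<Rightarrow> nat \<Rightarrow> real \<Rightarrow> vec \<Rightarrow> nat" where
  "s_hat \<alpha> \<alpha>' d \<sigma> X = 2 ^ m_hat \<alpha> \<alpha>' d \<sigma> X"

definition u_ad :: "real \<Rightarrow> real \<Rightarrow> nat \<Rightarrow> real" where
  "u_ad \<alpha> \<alpha>' s =
     sqrt (2 * ln (4 * real s / ((\<alpha> - \<alpha>') * Cfun (2 * real s) (\<alpha> - \<alpha>'))))"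

definition L_ad :: "real \<Rightarrow> real \<Rightarrow> nat \<Rightarrow> real \<Rightarrow> lower" where
  "L_ad \<alpha> \<alpha>' d \<sigma> X j =
     (if j \<in> S_ad \<alpha> \<alpha>' d \<sigma> X then max (X j - u_ad \<alpha> \<alpha>' (s_hat \<alpha> \<alpha>' d \<sigma> X) * \<sigma>) 0 else 0)"

definition U_ad :: "real \<Rightarrow> real \<Rightarrow> nat \<Rightarrow> real \<Rightarrow> upper" where
  "U_ad \<alpha> \<alpha>' d \<sigma> X j = (if j \<in> S_ad \<alpha> \<alpha>' d \<sigma> X then \<infinity> else 0)"

definition xi_bar :: "nat \<Rightarrow> nat \<Rightarrow> real" where
  "xi_bar d s = sqrt (max (2 * ln (ln (real d - real s)) - ln (ln (real s))) 0)"

definition signal_bound :: "real \<Rightarrow> nat \<Rightarrow> nat \<Rightarrow> real" where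
  "signal_bound C' d s =
     sqrt (2 * ln (real d - real s) - ln (ln (real d - real s)) + C') +
     max (sqrt (2 * ln (real s) - ln (ln (real s)) + C')) (xi_bar d s)"

end

theory Submission
  imports Defs "HOL-Real_Asymp.Real_Asymp"
begin

text \<open>
  Write \<open>\<beta> = \<alpha> - \<alpha>'\<close>, \<open>t(x) = sqrt (2 log x - log (\<pi> log x))\<close> and \<open>Q\<close> for the upper tail of the
  standard normal law. The selection threshold is \<open>t(d/\<beta>)\<close>, the width is \<open>t(2 s/\<beta>)\<close> at the estimated
  sparsity, and Mills' inequality gives \<open>Q(t(x)) \<le> (1 + o(1)) / (2 x)\<close>.

  Coverage fails only if (1) a nonzero coordinate is missed, (2) a null coordinate is selected, or
  (3) some \<open>X\<^sub>j - \<theta>\<^sub>j\<close> on the support exceeds the width. The signal condition bounds (1) by \<open>\<alpha>'\<close>. Off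
  (1) the estimated sparsity is at least the number \<open>k\<close> of nonzero coordinates, so the random width
  in (3) may be replaced by the deterministic \<open>t(2 k/\<beta>)\<close>. The constants must work for every \<open>k\<close>,
  small ones included: \<open>Q(t(x)) \<le> (4/5) / x\<close> for all \<open>x > 1\<close> bounds (3) by \<open>(2/5) \<beta>\<close>, and
  \<open>Q(t(x)) \<le> (3/5) / x\<close> for large \<open>x\<close> bounds (2) by \<open>(3/5) \<beta>\<close>, for a total of \<open>\<alpha>\<close>.

  For the risk, the estimated sparsity is at most \<open>2 (s + N)\<close> with \<open>N\<close> the number of false
  positives, whose mean is at most 1, so the expected width is \<open>sqrt (2 log s) (1 + o(1))\<close>. A missed
  coordinate costs \<open>\<theta>\<^sub>j Q(\<theta>\<^sub>j/\<sigma> - t(d/\<beta>))\<close>, which is at most \<open>2 \<sigma>\<close>; this is where \<open>xi_bar\<close> enters.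
\<close>

subsection \<open>Gaussian tails\<close>

definition gtail :: "real \<Rightarrow> real" where
  "gtail c = measure (density lborel std_normal_density) {c..}"

lemma gtail_nonneg: "0 \<le> gtail c"
  by (simp add: gtail_def)

lemma gtail_antimono: "b \<le> c \<Longrightarrow> gtail c \<le> gtail b"
proof -
  interpret N: prob_space "density lborel std_normal_density"
    by (rule prob_space_normal_density) simp
  show "b \<le> c \<Longrightarrow> gtail c \<le> gtail b"
    unfolding gtail_def by (rule N.finite_measure_mono) auto
qed

lemma std_normal_density_tendsto_0: "(std_normal_density \<longlongrightarrow> 0) at_top"
  unfolding normal_density_def by real_asymp

text \<open>On \<open>[c, \<infinity>)\<close> the density is at most \<open>x / c\<close> times
  itself, and \<open>x * std_normal_density x\<close> has the antiderivative
  \<open>- std_normal_density x\<close>.\<close>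

lemma gtail_le_mills:
  assumes "0 < c"
  shows "gtail c \<le> std_normal_density c / c"
proof -
  have "emeasure (density lborel std_normal_density) {c..}
      = (\<integral>\<^sup>+x. ennreal (std_normal_density x) * indicator {c..} x \<partial>lborel)"
    by (subst emeasure_density) auto
  also have "\<dots> \<le> (\<integral>\<^sup>+x. ennreal (x * std_normal_density x / c) * indicator {c..} x \<partial>lborel)"
  proof (intro nn_integral_mono)
    fix x
    show "ennreal (std_normal_density x) * indicator {c..} x
        \<le> ennreal (x * std_normal_density x / c) * indicator {c..} x"
    proof (cases "c \<le> x")
      case True
      then have "c * std_normal_density x \<le> x * std_normal_density x"
        by (rule mult_right_mono) (rule normal_density_nonneg)
      then show ?thesis
        using assms True by (simp add: le_divide_eq ennreal_leI mult.commute)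
    qed auto
  qed
  also have "\<dots> = ennreal (0 - (- std_normal_density c / c))"
  proof (rule nn_integral_FTC_atLeast[where F = "\<lambda>x. - std_normal_density x / c"])
    show "((\<lambda>x. - std_normal_density x / c) \<longlongrightarrow> 0) at_top"
      using tendsto_divide[OF tendsto_minus[OF std_normal_density_tendsto_0] tendsto_const[of c]] assms
      by simp
    show "((\<lambda>x. - std_normal_density x / c) has_real_derivative x * std_normal_density x / c) (at x)" for x
      using assms unfolding normal_density_def
      by (auto intro!: derivative_eq_intros simp: field_simps power2_eq_square)
    show "0 \<le> x * std_normal_density x / c" if "c \<le> x" for x
      using assms that by simp
  qed simp
  finally show ?thesis
    using assms unfolding gtail_def measure_def
    by (auto intro!: enn2real_leI)
qed

lemma std_normal_density_le_1: "std_normal_density x \<le> 1"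
proof -
  have "std_normal_density x \<le> 1 / sqrt (2 * pi)"
    by (simp add: std_normal_density_def divide_right_mono)
  also have "\<dots> \<le> 1"
    using pi_gt3 by (simp add: real_le_rsqrt)
  finally show ?thesis .
qed

text \<open>Mills' inequality with a density below 1. It controls the cost of a missed coordinate in
  the risk.\<close>

lemma mult_gtail_le_1:
  assumes "0 < c"
  shows "c * gtail c \<le> 1"
  using gtail_le_mills[OF assms] std_normal_density_le_1[of c] assms
  by (simp add: le_divide_eq mult.commute)

section \<open>Laws of the coordinates of the Gaussian vector\<close>

lemma gauss_prob_space: "0 < \<sigma> \<Longrightarrow> prob_space (gauss d \<sigma> \<theta>)"
  unfolding gauss_def by (intro prob_space_PiM prob_space_normal_density)

lemma space_gauss: "space (gauss d \<sigma> \<theta>) = Rd d"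
  by (simp add: gauss_def space_PiM Rd_def)

lemma sets_gauss [measurable_cong]: "sets (gauss d \<sigma> \<theta>) = sets (Pi\<^sub>M {1..d} (\<lambda>_. borel))"
  unfolding gauss_def by (intro sets_PiM_cong) simp_all

text \<open>A coordinate of a product measure has the marginal law, and an affine map standardises
  it. Both signs are used: positive noise causes false selections and large lower bounds, negative
  noise causes misses.\<close>

lemma gauss_distributed:
  assumes "0 < \<sigma>" "j \<in> {1..d}"
  shows "distributed (gauss d \<sigma> \<theta>) lborel (\<lambda>X. (X j - \<theta> j) / \<sigma>) std_normal_density"
    and "distributed (gauss d \<sigma> \<theta>) lborel (\<lambda>X. (\<theta> j - X j) / \<sigma>) std_normal_density"
proof -
  interpret prob_space "gauss d \<sigma> \<theta>" using gauss_prob_space[OF assms(1)] .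
  have m: "(\<lambda>X. X j) \<in> measurable (gauss d \<sigma> \<theta>) lborel"
    using assms(2) by measurable
  have "distr (gauss d \<sigma> \<theta>) (density lborel (normal_density (\<theta> j) \<sigma>)) (\<lambda>X. X j)
      = density lborel (normal_density (\<theta> j) \<sigma>)"
    unfolding gauss_def
    by (rule distr_PiM_component[of "{1..d}" "\<lambda>j. density lborel (normal_density (\<theta> j) \<sigma>)"])
       (use assms in \<open>auto intro: prob_space_normal_density\<close>)
  \<comment> \<open>\<open>distr\<close> depends on its target measure only through the sets;
    \<open>lborel\<close> is the target in \<open>distributed\<close>.\<close>
  moreover have "distr (gauss d \<sigma> \<theta>) (density lborel (normal_density (\<theta> j) \<sigma>)) (\<lambda>X. X j)
     = distr (gauss d \<sigma> \<theta>) lborel (\<lambda>X. X j)"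
    by (rule distr_cong) auto
  ultimately have "distributed (gauss d \<sigma> \<theta>) lborel (\<lambda>X. X j) (normal_density (\<theta> j) \<sigma>)"
    using m by (simp add: distributed_def)
  from normal_density_affine[OF this assms(1), of "1 / \<sigma>" "- \<theta> j / \<sigma>"]
       normal_density_affine[OF this assms(1), of "- 1 / \<sigma>" "\<theta> j / \<sigma>"]
  show "distributed (gauss d \<sigma> \<theta>) lborel (\<lambda>X. (X j - \<theta> j) / \<sigma>) std_normal_density"
    and "distributed (gauss d \<sigma> \<theta>) lborel (\<lambda>X. (\<theta> j - X j) / \<sigma>) std_normal_density"
    using assms(1) by (simp_all add: diff_divide_distrib)
qed

lemma (in prob_space) std_normal_tail:
  assumes "distributed M lborel Z std_normal_density"
  shows "measure M {x\<in>space M. c \<le> Z x} = gtail c"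
proof -
  have m: "Z \<in> borel_measurable M"
    using distributed_measurable[OF assms] by simp
  have "gtail c = measure (distr M lborel Z) {c..}"
    by (simp add: gtail_def distributed_distr_eq_density[OF assms])
  also have "\<dots> = measure M (Z -` {c..} \<inter> space M)"
    by (rule measure_distr) (use m in auto)
  also have "Z -` {c..} \<inter> space M = {x\<in>space M. c \<le> Z x}"
    by auto
  finally show ?thesis by simp
qed

lemma gauss_upper_tail:
  assumes "0 < \<sigma>" "j \<in> {1..d}"
  shows "measure (gauss d \<sigma> \<theta>) {X\<in>Rd d. c \<le> (X j - \<theta> j) / \<sigma>} = gtail c"
  using prob_space.std_normal_tail[OF gauss_prob_space gauss_distributed(1)] assms
  by (simp add: space_gauss)

lemma gauss_lower_tail:
  assumes "0 < \<sigma>" "j \<in> {1..d}"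
  shows "measure (gauss d \<sigma> \<theta>) {X\<in>Rd d. c \<le> (\<theta> j - X j) / \<sigma>} = gtail c"
  using prob_space.std_normal_tail[OF gauss_prob_space gauss_distributed(2)] assms
  by (simp add: space_gauss)

lemma gauss_abs_moment:
  assumes "0 < \<sigma>" "j \<in> {1..d}"
  shows "integrable (gauss d \<sigma> \<theta>) (\<lambda>X. \<bar>(X j - \<theta> j) / \<sigma>\<bar>)"
    and "(\<integral>X. \<bar>(X j - \<theta> j) / \<sigma>\<bar> \<partial>gauss d \<sigma> \<theta>) \<le> 1"
proof -
  have b: "has_bochner_integral lborel (\<lambda>x. std_normal_density x * \<bar>x\<bar>) (sqrt (2 / pi))"
    using std_normal_moment_abs_odd[of 0] by simp
  show "integrable (gauss d \<sigma> \<theta>) (\<lambda>X. \<bar>(X j - \<theta> j) / \<sigma>\<bar>)"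
    using distributed_integrable[OF gauss_distributed(1)[OF assms], of abs \<theta>] b
    by (auto simp: has_bochner_integral_iff)
  have "(\<integral>X. \<bar>(X j - \<theta> j) / \<sigma>\<bar> \<partial>gauss d \<sigma> \<theta>) = sqrt (2 / pi)"
    using distributed_integral[OF gauss_distributed(1)[OF assms], of abs \<theta>] b
    by (auto simp: has_bochner_integral_iff)
  also have "\<dots> \<le> 1"
    using pi_gt3 by simp
  finally show "(\<integral>X. \<bar>(X j - \<theta> j) / \<sigma>\<bar> \<partial>gauss d \<sigma> \<theta>) \<le> 1" .
qed

subsection \<open>The threshold function\<close>

text \<open>For \<open>x > 1\<close> the correction \<open>ln (pi * ln x)\<close> makes the normal
  density at \<open>thr x\<close> equal to \<open>sqrt (ln x / 2) / x\<close>, so that Mills' bound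
  behaves like \<open>1 / (2 * x)\<close>.\<close>

definition thr :: "real \<Rightarrow> real" where
  "thr x = sqrt (2 * ln x - ln (pi * ln x))"

text \<open>Both levels of the construction have this form: \<open>y = d\<close> is the selection
  level and \<open>y = 2 * n\<close> the width at sparsity \<open>n\<close>.\<close>

lemma Cfun_threshold_eq_thr:
  assumes "0 < \<beta>" "\<beta> < y"
  shows "sqrt (2 * ln (2 * y / (\<beta> * Cfun y \<beta>))) = thr (y / \<beta>)"
proof -
  have x: "1 < y / \<beta>" and y: "0 < y" using assms by simp_all
  then have p: "0 < pi * ln (y / \<beta>)" by simp
  have "2 * y / (\<beta> * Cfun y \<beta>) = (y / \<beta>) / sqrt (pi * ln (y / \<beta>))"
    by (simp add: Cfun_def)
  also have "ln \<dots> = ln (y / \<beta>) - ln (pi * ln (y / \<beta>)) / 2"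
    using x y p assms(1) by (subst ln_div) (simp_all add: ln_sqrt del: real_sqrt_mult)
  finally show ?thesis
    by (simp add: thr_def algebra_simps)
qed

text \<open>The last hypothesis says that \<open>thr x\<close> is at least
  \<open>sqrt (ln x / 2) / \<kappa>\<close>. Dividing the density value
  \<open>sqrt (ln x / 2) / x\<close> by this bound gives \<open>\<kappa> / x\<close>. Every
  \<open>\<kappa>\<close> above \<open>1 / 2\<close> is admissible for large
  \<open>x\<close>.\<close>

lemma gtail_thr_le_of:
  assumes x: "1 < x" and k: "0 < \<kappa>"
    and le: "ln (pi * ln x) \<le> (2 - 1 / (2 * \<kappa>\<^sup>2)) * ln x"
  shows "gtail (thr x) \<le> \<kappa> / x"
proof -
  define y where "y = ln x"
  define q where "q = 2 * y - ln (pi * y)"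
  have y: "0 < y" using x by (simp add: y_def)
  have q: "y / (2 * \<kappa>\<^sup>2) \<le> q"
    using le by (simp add: q_def y_def algebra_simps)
  have pos: "0 < y / (2 * \<kappa>\<^sup>2)" using y k by simp
  have thr: "thr x = sqrt q" by (simp add: thr_def q_def y_def)
  have tge: "sqrt (y / 2) / \<kappa> \<le> thr x"
  proof -
    have "sqrt (y / 2) / \<kappa> = sqrt (y / (2 * \<kappa>\<^sup>2))"
      using k by (simp add: real_sqrt_divide real_sqrt_mult)
    then show ?thesis using q by (simp add: thr)
  qed
  have t0: "0 < thr x" using pos q by (simp add: thr)
  have "std_normal_density (thr x) = exp (- q / 2) / sqrt (2 * pi)"
    using pos q by (simp add: std_normal_density_def thr)
  also have "exp (- q / 2) = sqrt (pi * y) / x"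
  proof -
    have "exp (- q / 2) = exp (ln (sqrt (pi * y)) - ln x)"
      using y by (simp add: q_def ln_sqrt y_def[symmetric] field_simps del: real_sqrt_mult)
    also have "\<dots> = sqrt (pi * y) / x"
      using y x by (simp add: exp_diff del: real_sqrt_mult)
    finally show ?thesis .
  qed
  also have "sqrt (pi * y) / x / sqrt (2 * pi) = sqrt (y / 2) / x"
    by (simp add: real_sqrt_mult real_sqrt_divide)
  finally have d: "std_normal_density (thr x) = sqrt (y / 2) / x" .
  have "gtail (thr x) \<le> sqrt (y / 2) / x / thr x"
    using gtail_le_mills[OF t0] d by simp
  also have "\<dots> \<le> \<kappa> / x"
    using tge t0 x k by (simp add: field_simps)
  finally show ?thesis .
qed

text \<open>The slope \<open>39 / 32\<close> is \<open>2 - 1 / (2 * \<kappa>\<^sup>2)\<close> at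
  \<open>\<kappa> = 4 / 5\<close>. The tangent of \<open>ln\<close> at \<open>exp 1\<close> gives
  the slope \<open>pi / exp 1\<close>, about 1.16, which is smaller.\<close>

lemma ln_pi_mult_le:
  assumes "0 < y"
  shows "ln (pi * y) \<le> 39 / 32 * y"
proof -
  \<comment> \<open>A rational lower bound for e, by squaring the quadratic Taylor bound of
    \<open>exp\<close> at \<open>1 / 2\<close>.\<close>
  have "(1 + 1/2 + (1/2)\<^sup>2 / 2 :: real)\<^sup>2 \<le> (exp (1/2))\<^sup>2"
    by (intro power_mono exp_lower_Taylor_quadratic) auto
  then have e: "(13/8)\<^sup>2 \<le> exp (1::real)"
    by (simp add: power2_eq_square flip: exp_add)
  have "ln (pi * y / exp 1) \<le> pi * y / exp 1 - 1"
    using assms by (intro ln_le_minus_one) simp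
  also have "ln (pi * y / exp 1) = ln (pi * y) - 1"
    using assms by (subst ln_div) simp_all
  finally have "ln (pi * y) \<le> pi / exp 1 * y" by simp
  also have "\<dots> \<le> 39 / 32 * y"
  proof (rule mult_right_mono)
    have "pi \<le> (39/32) * (13/8)\<^sup>2"
      using pi_approx by (simp add: power2_eq_square)
    also have "\<dots> \<le> (39/32) * exp (1::real)" using e by simp
    finally show "pi / exp 1 \<le> 39 / 32"
      by (simp add: field_simps)
  qed (use assms in simp)
  finally show ?thesis .
qed

lemma gtail_thr_le: "1 < x \<Longrightarrow> gtail (thr x) \<le> 4 / 5 / x"
  using ln_pi_mult_le[of "ln x"] by (intro gtail_thr_le_of) (auto simp: power2_eq_square)

lemma eventually_gtail_thr_le:
  "eventually (\<lambda>x. gtail (thr x) \<le> 3 / 5 / x) at_top"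
proof -
  \<comment> \<open>\<open>11 / 18\<close> is \<open>2 - 1 / (2 * \<kappa>\<^sup>2)\<close> at
    \<open>\<kappa> = 3 / 5\<close>.\<close>
  have "eventually (\<lambda>x::real. c + ln (ln x) \<le> 11 / 18 * ln x) at_top" for c :: real
    by real_asymp
  from this[of "ln pi"] eventually_gt_at_top[of 1] show ?thesis
    by eventually_elim (rule gtail_thr_le_of, auto simp: power2_eq_square ln_mult)
qed

text \<open>The slope \<open>39 / 32\<close> is below 2, so the radicand is nonnegative;
  \<open>sqrt\<close> of a negative real would be negative.\<close>

lemma thr_nonneg:
  assumes "1 < x"
  shows "0 \<le> thr x"
proof -
  have "0 < ln x" using assms by simp
  then have "ln (pi * ln x) \<le> 2 * ln x"
    using ln_pi_mult_le[OF \<open>0 < ln x\<close>] by linarith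
  then show ?thesis by (simp add: thr_def)
qed

lemma half_le_ln: "2 \<le> x \<Longrightarrow> 1 / 2 < ln (x::real)"
  using ln2_ge_two_thirds ln_mono[of 2 x] by linarith

text \<open>As a function of \<open>y = ln x\<close> the radicand has derivative
  \<open>2 - 1 / y\<close>, and \<open>x \<ge> 2\<close> gives \<open>y > 1 / 2\<close>. This turns
  comparisons of sparsities into comparisons of widths.\<close>

lemma thr_mono:
  assumes "2 \<le> x" "x \<le> x'"
  shows "thr x \<le> thr x'"
proof -
  define y y' where "y = ln x" and "y' = ln x'"
  have y: "1 / 2 < y" using half_le_ln[OF assms(1)] by (simp add: y_def)
  have yy: "y \<le> y'" using assms by (simp add: y_def y'_def)
  have "ln y' - ln y \<le> (y' - y) / y"
    using y yy by (intro ln_diff_le) auto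
  also have "\<dots> \<le> 2 * (y' - y)"
    using y yy mult_right_mono[of 1 "2 * y" "y' - y"] by (simp add: divide_le_eq mult_ac)
  finally have "2 * y - ln (pi * y) \<le> 2 * y' - ln (pi * y')"
    using y yy by (simp add: ln_mult)
  then show ?thesis by (simp add: thr_def y_def y'_def)
qed

lemma thr_le:
  assumes "2 \<le> x"
  shows "thr x \<le> sqrt (2 * ln x)"
proof -
  have "1 \<le> 2 * ln x" using half_le_ln[OF assms] by simp
  also have "\<dots> \<le> pi * ln x" using half_le_ln[OF assms] pi_ge_two by (intro mult_right_mono) auto
  finally show ?thesis by (simp add: thr_def)
qed


subsection \<open>The estimated sparsity\<close>

lemma grid_top_bounds:
  assumes "1 \<le> d"
  shows "2 ^ grid_top d \<le> d" "d < 2 ^ Suc (grid_top d)"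
proof -
  \<comment> \<open>\<open>GREATEST\<close> is meaningful only for a bounded set of exponents;
    \<open>t < 2 ^ t\<close> bounds them by \<open>d\<close>.\<close>
  have b: "2 ^ t \<le> d \<Longrightarrow> t \<le> d" for t
    by (rule less_imp_le[OF less_le_trans[OF less_exp]])
  have "2 ^ 0 \<le> d" using assms by simp
  from GreatestI_nat[where P = "\<lambda>t. 2 ^ t \<le> d", OF this b]
  show "2 ^ grid_top d \<le> d"
    unfolding grid_top_def .
  show "d < 2 ^ Suc (grid_top d)"
  proof (rule ccontr)
    assume "\<not> ?thesis"
    then have "2 ^ Suc (grid_top d) \<le> d" by (simp only: not_less)
    from Greatest_le_nat[where P = "\<lambda>t. 2 ^ t \<le> d", OF this b]
    have "Suc (grid_top d) \<le> grid_top d"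
      unfolding grid_top_def .
    then show False by simp
  qed
qed

text \<open>The dyadic blocks are disjoint, so \<open>THE\<close> is legitimate. They cover every
  size from 1 up to, but excluding, \<open>2 ^ grid_top d\<close>, so only the remaining sizes reach
  the default.\<close>

lemma m_hat_cases:
  fixes \<alpha> \<alpha>' \<sigma> :: real and X :: vec
  assumes "1 \<le> d"
  defines "c \<equiv> card (S_ad \<alpha> \<alpha>' d \<sigma> X)"
  obtains "2 ^ (m_hat \<alpha> \<alpha>' d \<sigma> X - 1) \<le> c" "c < 2 ^ m_hat \<alpha> \<alpha>' d \<sigma> X"
  | "m_hat \<alpha> \<alpha>' d \<sigma> X = grid_top d" "c = 0 \<or> 2 ^ grid_top d \<le> c"
proof -
  define P where "P = (\<lambda>m. m \<in> {1..grid_top d} \<and> 2 ^ (m - 1) \<le> c \<and> c < 2 ^ m)"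
  have m: "m_hat \<alpha> \<alpha>' d \<sigma> X = (if \<exists>m. P m then THE m. P m else grid_top d)"
    unfolding m_hat_def P_def c_def Let_def by (rule refl)
  show thesis
  proof (cases "\<exists>m. P m")
    case True
    have le: "m \<le> n" if "P m" "P n" for m n
    proof -
      have "(2::nat) ^ (m - 1) < 2 ^ n"
        using that unfolding P_def by linarith
      then have "m - 1 < n" by simp
      then show ?thesis using that unfolding P_def by auto
    qed
    have "\<exists>!m. P m"
      using True le by (blast intro: antisym)
    from theI'[OF this] have "P (m_hat \<alpha> \<alpha>' d \<sigma> X)"
      using True by (simp add: m)
    then show thesis by (intro that(1)) (simp_all add: P_def)
  next
    case False
    have "c = 0 \<or> 2 ^ grid_top d \<le> c"
    proof (rule ccontr)
      assume *: "\<not> ?thesis"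
      \<comment> \<open>Blocks are indexed by their upper exponent, hence the witness
        \<open>Suc n\<close> below.\<close>
      then obtain n where n: "2 ^ n \<le> c" "c < 2 ^ (n + 1)"
        using ex_power_ivl1[of 2 "c"] by auto
      then have "(2::nat) ^ n < 2 ^ grid_top d" using * by linarith
      then have "P (Suc n)" using n by (simp add: P_def)
      with False show False by blast
    qed
    with False show thesis by (intro that(2)) (simp_all add: m)
  qed
qed

text \<open>In a dyadic block the estimate exceeds the size of the selected set. At the default it
  exceeds \<open>d / 2\<close>, and there \<open>2 * k \<le> d\<close> is what helps.\<close>

lemma le_s_hat:
  assumes "1 \<le> d" "2 * k \<le> d" "k \<le> card (S_ad \<alpha> \<alpha>' d \<sigma> X)"
  shows "k \<le> s_hat \<alpha> \<alpha>' d \<sigma> X"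
  using assms(1)
proof (cases rule: m_hat_cases[where \<alpha> = \<alpha> and \<alpha>' = \<alpha>' and \<sigma> = \<sigma> and X = X])
  case 1
  show ?thesis
    unfolding s_hat_def by (rule less_imp_le[OF le_less_trans[OF assms(3) 1(2)]])
next
  case 2
  have "k \<le> p" if "d < 2 * p" for p
    using that assms(2) by simp
  from this[OF grid_top_bounds(2)[OF assms(1), unfolded power_Suc]] show ?thesis
    unfolding s_hat_def 2(1) .
qed

text \<open>In a dyadic block the estimate is at most twice the lower end of the block. At the
  default a nonempty selection has at least \<open>2 ^ grid_top d\<close> elements.\<close>

lemma s_hat_le:
  assumes "1 \<le> d" "1 \<le> card (S_ad \<alpha> \<alpha>' d \<sigma> X)"
  shows "s_hat \<alpha> \<alpha>' d \<sigma> X \<le> 2 * card (S_ad \<alpha> \<alpha>' d \<sigma> X)"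
  using assms(1)
proof (cases rule: m_hat_cases[where \<alpha> = \<alpha> and \<alpha>' = \<alpha>' and \<sigma> = \<sigma> and X = X])
  case 1
  \<comment> \<open>With truncated subtraction, \<open>m = 0\<close> is a separate case, settled by
    \<open>1 \<le> n\<close>.\<close>
  have "2 ^ m \<le> 2 * n" if "2 ^ (m - 1) \<le> n" "1 \<le> n" for m n :: nat
    using that by (cases m) simp_all
  from this[OF 1(1) assms(2)] show ?thesis
    unfolding s_hat_def .
next
  case 2
  have "p \<le> 2 * n" if "n = 0 \<or> p \<le> n" "1 \<le> n" for p n :: nat
    using that by auto
  from this[OF 2(2) assms(2)] show ?thesis
    unfolding s_hat_def 2(1) .
qed

lemma s_hat_ge_1: "1 \<le> s_hat \<alpha> \<alpha>' d \<sigma> X"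
  by (simp add: s_hat_def)

subsection \<open>Coverage and risk for fixed dimension and sparsity\<close>

text \<open>One fixed pair of dimension and sparsity. Requirements that hold only for large
  \<open>d\<close> are hypotheses of the individual lemmas.\<close>

locale adaptive_set =
  fixes \<alpha> \<alpha>' \<beta> \<sigma> :: real and d :: nat
  assumes beta: "\<alpha> - \<alpha>' = \<beta>" "0 < \<beta>" "\<beta> < 1" and sigma: "0 < \<sigma>" and d: "1 \<le> d"
begin

abbreviation t :: real where "t \<equiv> thr (real d / \<beta>)"
abbreviation S :: sel where "S \<equiv> S_ad \<alpha> \<alpha>' d \<sigma>"
abbreviation U :: upper where "U \<equiv> U_ad \<alpha> \<alpha>' d \<sigma>"
abbreviation L :: lower where "L \<equiv> L_ad \<alpha> \<alpha>' d \<sigma>"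
abbreviation shat :: "vec \<Rightarrow> nat" where "shat \<equiv> s_hat \<alpha> \<alpha>' d \<sigma>"

section \<open>Selection rule, measurability and membership in the classes\<close>

lemma mem_S: "j \<in> S X \<longleftrightarrow> j \<in> {1..d} \<and> t \<le> X j / \<sigma>"
  using Cfun_threshold_eq_thr[of \<beta> "real d"] beta d by (simp add: S_ad_def)

lemma u_ad_eq_thr: "1 \<le> n \<Longrightarrow> u_ad \<alpha> \<alpha>' n = thr (2 * real n / \<beta>)"
  using Cfun_threshold_eq_thr[of \<beta> "2 * real n"] beta by (simp add: u_ad_def)

lemma t_nonneg: "0 \<le> t"
  using beta d by (intro thr_nonneg) (simp add: less_divide_eq)

lemma gtail_t_le: "gtail t \<le> 4 / 5 * \<beta> / real d"
  using gtail_thr_le[of "real d / \<beta>"] beta d by (simp add: less_divide_eq)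

lemma measurable_S: "{X \<in> space (Pi\<^sub>M {1..d} (\<lambda>_. borel)). i \<in> S X} \<in> sets (Pi\<^sub>M {1..d} (\<lambda>_. borel))"
proof (cases "i \<in> {1..d}")
  case True
  then have [measurable]: "(\<lambda>X. X i) \<in> borel_measurable (Pi\<^sub>M {1..d} (\<lambda>_. borel :: real measure))"
    by measurable
  show ?thesis unfolding mem_S using True by measurable
qed (simp add: mem_S)

lemma measurable_shat [measurable]:
  "shat \<in> measurable (Pi\<^sub>M {1..d} (\<lambda>_. borel)) (count_space UNIV)"
proof -
  have [measurable]: "(\<lambda>X. card (S X)) \<in> measurable (Pi\<^sub>M {1..d} (\<lambda>_. borel)) (count_space UNIV)"
    by (rule measurable_card) (rule measurable_S)
  show ?thesis unfolding s_hat_def m_hat_def by measurable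
qed

text \<open>Under the null law a coordinate is selected with probability exactly
  \<open>gtail t\<close>.\<close>

lemma S_in_selectors:
  assumes "gtail t \<le> 1 - \<delta>"
  shows "S \<in> selectors d \<sigma> \<delta>"
proof -
  have [measurable]: "{x. t \<le> x / \<sigma>} \<in> sets borel" by measurable
  have "measure (density lborel (normal_density 0 \<sigma>)) {x. t \<le> x / \<sigma>} = gtail t"
  proof -
    interpret N: prob_space "density lborel (normal_density 0 \<sigma>)"
      using sigma by (rule prob_space_normal_density)
    have "distributed (density lborel (normal_density 0 \<sigma>)) lborel (\<lambda>x. x) (normal_density 0 \<sigma>)"
      by (simp add: distributed_def distr_id2)
    then have "distributed (density lborel (normal_density 0 \<sigma>)) lborel (\<lambda>x. (x - 0) / \<sigma>) std_normal_density"
      by (simp only: N.normal_standard_normal_convert[OF sigma])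
    from N.std_normal_tail[OF this] show ?thesis by simp
  qed
  with assms show ?thesis
    unfolding selectors_def
    by (auto intro!: bexI[of _ "{x. t \<le> x / \<sigma>}"] simp: mem_S simp del: atLeastAtMost_iff)
qed

text \<open>Freezing the estimated sparsity at an attained value \<open>n\<close> leaves the
  selector unchanged and makes each bound a function of its own coordinate. Attained values are at
  least 1, so the width is nonnegative and the lower bound stays below
  \<open>max (X j) 0\<close>.\<close>

lemma mem_CI_plus_tuned: "(S, U, L) \<in> CI_plus_tuned d shat"
  unfolding CI_plus_tuned_def mem_Collect_eq prod.case
proof (intro conjI allI exI ballI)
  have sp: "Rd d = space (Pi\<^sub>M {1..d} (\<lambda>_. borel))"
    by (simp add: Rd_def space_PiM)
  show "{X \<in> Rd d. shat X = n} \<in> sets (Pi\<^sub>M {1..d} (\<lambda>_. borel))" for n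
    unfolding sp by measurable
  show "U X j = (\<lambda>_. U) (shat X) X j" for X j by simp
  let ?L = "\<lambda>n X j. if j \<in> S X then max (X j - u_ad \<alpha> \<alpha>' n * \<sigma>) 0 else 0"
  show "L X j = ?L (shat X) X j" for X j by (simp add: L_ad_def)
  fix n assume "n \<in> shat ` Rd d"
  then have n: "1 \<le> n" using s_hat_ge_1 by auto
  then have u: "0 \<le> u_ad \<alpha> \<alpha>' n"
    using beta by (auto simp: u_ad_eq_thr less_divide_eq intro!: thr_nonneg)
  show "(S, U, ?L n) \<in> CI_plus d"
    unfolding CI_plus_def mem_Collect_eq prod.case
  proof (intro conjI ballI)
    show "S X \<subseteq> {1..d}" for X by (auto simp: mem_S)
    fix j assume j: "j \<in> {1..d}"
    show "depends_only_on d j (\<lambda>X. ?L n X j)"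
      unfolding depends_only_on_def mem_S using j
      by (intro bexI[of _ "\<lambda>x. if t \<le> x / \<sigma> then max (x - u_ad \<alpha> \<alpha>' n * \<sigma>) 0 else 0"]) auto
    show "depends_only_on d j (\<lambda>X. U X j)"
      unfolding depends_only_on_def U_ad_def mem_S using j
      by (intro bexI[of _ "\<lambda>x. if t \<le> x / \<sigma> then \<infinity> else 0"]) auto
    show "if j \<in> S X then 0 \<le> ?L n X j \<and> ?L n X j \<le> max (X j) 0 \<and> U X j = \<infinity>
          else ?L n X j = 0 \<and> U X j = 0" for X
      using mult_nonneg_nonneg[OF u less_imp_le[OF sigma]] by (auto simp: U_ad_def max_def)
  qed
qed

text \<open>Three union bounds share the error \<open>\<alpha>\<close>: \<open>miss\<close> pays for
  missed signals, \<open>false_pos\<close> for selected null coordinates, and the remaining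
  \<open>2 / 5 * \<beta>\<close> for lower bounds that are too large.\<close>

lemma coverage:
  assumes th: "\<theta> \<in> Theta_plus d s a" and a: "0 < a" and sd: "2 * s \<le> d"
    and miss: "real s * gtail (a / \<sigma> - t) \<le> \<alpha>'"
    and false_pos: "real d * gtail t \<le> 3 / 5 * \<beta>"
  shows "1 - \<alpha> \<le> measure (gauss d \<sigma> \<theta>) {X\<in>Rd d. \<theta> \<in> conf_set d S U L X}"
proof -
  interpret M: prob_space "gauss d \<sigma> \<theta>" by (rule gauss_prob_space) (rule sigma)
  define J where "J = {j\<in>{1..d}. \<theta> j \<noteq> 0}"
  define k where "k = card J"
  \<comment> \<open>The width at the true number of nonzero coordinates is deterministic, so each
    \<open>B3 j\<close> is a Gaussian tail event of one coordinate.\<close>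
  define c where "c = thr (2 * real k / \<beta>)"
  define A where "A = {X\<in>Rd d. \<theta> \<in> conf_set d S U L X}"
  define B1 where "B1 = (\<lambda>j. {X\<in>Rd d. a / \<sigma> - t \<le> (\<theta> j - X j) / \<sigma>})"
  define B2 where "B2 = (\<lambda>j. {X\<in>Rd d. t \<le> (X j - \<theta> j) / \<sigma>})"
  define B3 where "B3 = (\<lambda>j. {X\<in>Rd d. c \<le> (X j - \<theta> j) / \<sigma>})"
  let ?I = "{1..d}"
  have J: "J \<subseteq> ?I" and fin: "finite J" by (auto simp: J_def)
  have ks: "k \<le> s" and Rd: "\<theta> \<in> Rd d" and ge: "\<And>j. j \<in> J \<Longrightarrow> a \<le> \<theta> j"
    using th by (auto simp: Theta_plus_def k_def J_def nnz_def)
  have k1: "1 \<le> k" if "j \<in> J" for j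
    using that fin by (simp add: k_def Suc_le_eq card_gt_0_iff) auto
  have meas_X: "(\<lambda>X. X j) \<in> borel_measurable (gauss d \<sigma> \<theta>)" if "j \<in> ?I" for j
    using that by measurable
  have meas_u: "(\<lambda>X. u_ad \<alpha> \<alpha>' (shat X)) \<in> borel_measurable (gauss d \<sigma> \<theta>)"
    by measurable
  have meas_B: "B1 j \<in> M.events" "B2 j \<in> M.events" "B3 j \<in> M.events" if "j \<in> ?I" for j
    using meas_X[OF that] unfolding B1_def B2_def B3_def space_gauss[symmetric, of d \<sigma> \<theta>]
    by measurable
  \<comment> \<open>Coordinatewise form, used for measurability; the infinite upper bound of a
    selected coordinate drops out.\<close>
  have A_eq: "A = {X\<in>space (gauss d \<sigma> \<theta>). \<forall>j\<in>?I. (t \<le> X j / \<sigma> \<or> \<theta> j = 0) \<and>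
      (t \<le> X j / \<sigma> \<longrightarrow> max (X j - u_ad \<alpha> \<alpha>' (shat X) * \<sigma>) 0 \<le> \<theta> j)}"
    using Rd by (auto simp: A_def conf_set_def L_ad_def U_ad_def mem_S space_gauss)
  have meas_A: "A \<in> M.events"
    unfolding A_eq
  proof (rule sets.sets_Collect_finite_All)
    fix j assume j: "j \<in> ?I"
    show "{X \<in> space (gauss d \<sigma> \<theta>). (t \<le> X j / \<sigma> \<or> \<theta> j = 0) \<and>
      (t \<le> X j / \<sigma> \<longrightarrow> max (X j - u_ad \<alpha> \<alpha>' (shat X) * \<sigma>) 0 \<le> \<theta> j)} \<in> M.events"
      using meas_X[OF j] meas_u by measurable
  qed simp
  have cover: "Rd d - A \<subseteq> (\<Union>j\<in>J. B1 j) \<union> (\<Union>j\<in>?I. if \<theta> j = 0 then B2 j else {}) \<union> (\<Union>j\<in>J. B3 j)"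
  proof (rule subsetI, rule ccontr)
    fix X assume X: "X \<in> Rd d - A"
      and *: "X \<notin> (\<Union>j\<in>J. B1 j) \<union> (\<Union>j\<in>?I. if \<theta> j = 0 then B2 j else {}) \<union> (\<Union>j\<in>J. B3 j)"
    have n1: "(\<theta> j - X j) / \<sigma> < a / \<sigma> - t" and n3: "(X j - \<theta> j) / \<sigma> < c" if "j \<in> J" for j
      using * X that by (auto simp: B1_def B3_def not_le)
    have n2: "X j / \<sigma> < t" if "j \<in> ?I" "\<theta> j = 0" for j
      using * X that by (auto simp: B2_def not_le)
    have sel: "t \<le> X j / \<sigma>" if "j \<in> J" for j
      using n1[OF that] divide_right_mono[OF ge[OF that], of \<sigma>] sigma
      by (simp add: diff_divide_distrib)
    \<comment> \<open>Selection of the whole support comes first: it bounds the estimated sparsity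
      from below by \<open>k\<close>, and only then is the random width at least
      \<open>c\<close>.\<close>
    have "J \<subseteq> S X" using sel J by (auto simp: mem_S)
    moreover have "S X \<subseteq> ?I" by (auto simp: mem_S)
    ultimately have "k \<le> card (S X)"
      unfolding k_def by (intro card_mono) (auto intro: finite_subset)
    then have kh: "k \<le> shat X"
      using d sd ks by (intro le_s_hat) auto
    have "max (X j - u_ad \<alpha> \<alpha>' (shat X) * \<sigma>) 0 \<le> \<theta> j" if "j \<in> J" for j
    proof -
      have "c \<le> u_ad \<alpha> \<alpha>' (shat X)"
        using k1[OF that] kh beta unfolding c_def u_ad_eq_thr[OF s_hat_ge_1]
        by (intro thr_mono divide_right_mono) (auto simp: le_divide_eq)
      with n3[OF that] have "(X j - \<theta> j) / \<sigma> \<le> u_ad \<alpha> \<alpha>' (shat X)" by linarith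
      then have "X j - \<theta> j \<le> u_ad \<alpha> \<alpha>' (shat X) * \<sigma>"
        using sigma by (simp add: divide_le_eq)
      then show ?thesis using ge[OF that] a by simp
    qed
    note low = this
    have "(t \<le> X j / \<sigma> \<or> \<theta> j = 0) \<and>
        (t \<le> X j / \<sigma> \<longrightarrow> max (X j - u_ad \<alpha> \<alpha>' (shat X) * \<sigma>) 0 \<le> \<theta> j)" if "j \<in> ?I" for j
    proof (cases "\<theta> j = 0")
      case True
      then show ?thesis using n2[OF that] by simp
    next
      case False
      then have "j \<in> J" using that by (simp add: J_def)
      then show ?thesis using low sel by blast
    qed
    then have "X \<in> A"
      using X by (simp add: A_eq space_gauss)
    with X show False by simp
  qed
  have "measure (gauss d \<sigma> \<theta>) (Rd d - A)
      \<le> measure (gauss d \<sigma> \<theta>) ((\<Union>j\<in>J. B1 j) \<union> (\<Union>j\<in>?I. if \<theta> j = 0 then B2 j else {}) \<union> (\<Union>j\<in>J. B3 j))"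
    using cover J fin meas_B
    by (intro M.finite_measure_mono sets.Un sets.finite_UN) auto
  also have "\<dots> \<le> measure (gauss d \<sigma> \<theta>) (\<Union>j\<in>J. B1 j)
      + measure (gauss d \<sigma> \<theta>) (\<Union>j\<in>?I. if \<theta> j = 0 then B2 j else {}) + measure (gauss d \<sigma> \<theta>) (\<Union>j\<in>J. B3 j)"
    using J fin meas_B
    by (intro order_trans[OF measure_Un_le] add_mono measure_Un_le sets.Un sets.finite_UN) auto
  also have "\<dots> \<le> \<alpha>' + 3 / 5 * \<beta> + 2 / 5 * \<beta>"
  proof (intro add_mono)
    have "measure (gauss d \<sigma> \<theta>) (\<Union>j\<in>J. B1 j) \<le> (\<Sum>j\<in>J. measure (gauss d \<sigma> \<theta>) (B1 j))"
      using J fin meas_B by (intro M.finite_measure_subadditive_finite) auto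
    also have "\<dots> = (\<Sum>j\<in>J. gtail (a / \<sigma> - t))"
      using J sigma by (intro sum.cong refl) (auto simp: B1_def intro!: gauss_lower_tail)
    also have "\<dots> \<le> real s * gtail (a / \<sigma> - t)"
      using ks by (simp add: k_def mult_right_mono gtail_nonneg)
    finally show "measure (gauss d \<sigma> \<theta>) (\<Union>j\<in>J. B1 j) \<le> \<alpha>'" using miss by linarith
    have "measure (gauss d \<sigma> \<theta>) (\<Union>j\<in>?I. if \<theta> j = 0 then B2 j else {})
        \<le> (\<Sum>j\<in>?I. measure (gauss d \<sigma> \<theta>) (if \<theta> j = 0 then B2 j else {}))"
      using meas_B by (intro M.finite_measure_subadditive_finite) auto
    also have "\<dots> \<le> (\<Sum>j\<in>?I. gtail t)"
    proof (rule sum_mono)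
      fix j assume "j \<in> ?I"
      from gauss_upper_tail[OF sigma this, of \<theta> t]
      show "measure (gauss d \<sigma> \<theta>) (if \<theta> j = 0 then B2 j else {}) \<le> gtail t"
        by (auto simp: B2_def gtail_nonneg)
    qed
    finally show "measure (gauss d \<sigma> \<theta>) (\<Union>j\<in>?I. if \<theta> j = 0 then B2 j else {}) \<le> 3 / 5 * \<beta>"
      using false_pos by simp
    have "measure (gauss d \<sigma> \<theta>) (\<Union>j\<in>J. B3 j) \<le> (\<Sum>j\<in>J. measure (gauss d \<sigma> \<theta>) (B3 j))"
      using J fin meas_B by (intro M.finite_measure_subadditive_finite) auto
    also have "\<dots> = (\<Sum>j\<in>J. gtail c)"
      using J sigma by (intro sum.cong refl) (auto simp: B3_def intro!: gauss_upper_tail)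
    also have "\<dots> = real k * gtail c" by (simp add: k_def)
    \<comment> \<open>At \<open>x = 2 * k / \<beta>\<close> the bound \<open>4 / 5 / x\<close> is
      \<open>2 / 5 * \<beta> / k\<close>. For \<open>k = 0\<close> the value \<open>c\<close> is
      meaningless, but the factor \<open>k\<close> vanishes.\<close>
    also have "\<dots> \<le> 2 / 5 * \<beta>"
    proof (cases "k = 0")
      case False
      then have "gtail c \<le> 4 / 5 / (2 * real k / \<beta>)"
        unfolding c_def using beta by (intro gtail_thr_le) (auto simp: less_divide_eq)
      from mult_left_mono[OF this, of "real k"] show ?thesis
        using False beta by simp
    qed (use beta in simp)
    finally show "measure (gauss d \<sigma> \<theta>) (\<Union>j\<in>J. B3 j) \<le> 2 / 5 * \<beta>" .
  qed
  also have "\<dots> = \<alpha>" using beta by simp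
  finally have "measure (gauss d \<sigma> \<theta>) (space (gauss d \<sigma> \<theta>) - A) \<le> \<alpha>" by (simp add: space_gauss)
  then show ?thesis
    using M.prob_compl[OF meas_A] by (simp add: A_def)
qed

text \<open>Here \<open>n\<close> stands for the number of false positives. The estimate is at most
  \<open>2 * (s + n)\<close>; writing \<open>s + n\<close> as \<open>s * (1 + n / s)\<close> and
  using subadditivity of \<open>sqrt\<close> isolates the effect of \<open>n\<close>. A bound linear
  in \<open>n\<close> suits taking expectations.\<close>

lemma u_ad_shat_le:
  assumes s: "1 \<le> s" and c: "1 \<le> card (S X)" "real (card (S X)) \<le> real s + n" and n: "0 \<le> n"
  shows "u_ad \<alpha> \<alpha>' (shat X) \<le> sqrt (2 * ln (4 * real s / \<beta>)) + 1 + n"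
proof -
  have sh: "1 \<le> shat X" "shat X \<le> 2 * card (S X)"
    using s_hat_ge_1 s_hat_le[OF d c(1)] by auto
  have n': "0 \<le> n / real s" "n / real s \<le> n"
    using n s by (auto simp: divide_le_eq mult_le_cancel_left1 intro: mult_left_mono)
  have "u_ad \<alpha> \<alpha>' (shat X) \<le> sqrt (2 * ln (2 * real (shat X) / \<beta>))"
    unfolding u_ad_eq_thr[OF sh(1)] using sh(1) beta by (intro thr_le) (simp add: le_divide_eq)
  also have "\<dots> \<le> sqrt (2 * ln (4 * real s / \<beta> * (1 + n / real s)))"
  proof -
    have "2 * real (shat X) \<le> 4 * (real s + n)"
      using of_nat_mono[OF sh(2), where 'a = real] c(2) by simp
    also have "\<dots> = 4 * real s * (1 + n / real s)"
      using s by (simp add: field_simps)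
    finally have "2 * real (shat X) / \<beta> \<le> 4 * real s / \<beta> * (1 + n / real s)"
      using beta by (simp add: divide_right_mono)
    then show ?thesis
      using sh(1) beta by (intro real_sqrt_le_mono mult_left_mono ln_mono) auto
  qed
  also have "\<dots> = sqrt (2 * ln (4 * real s / \<beta>) + 2 * ln (1 + n / real s))"
    using s beta n' by (subst ln_mult) auto
  also have "\<dots> \<le> sqrt (2 * ln (4 * real s / \<beta>)) + sqrt (2 * ln (1 + n / real s))"
    using s beta n' by (intro sqrt_add_le_add_sqrt mult_nonneg_nonneg ln_ge_zero) (auto simp: le_divide_eq)
  also have "sqrt (2 * ln (1 + n / real s)) \<le> 1 + n"
  proof (rule real_le_lsqrt)
    have "ln (1 + n / real s) \<le> n"
      using ln_add_one_self_le_self[OF n'(1)] n'(2) by linarith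
    then show "2 * ln (1 + n / real s) \<le> (1 + n)\<^sup>2"
      using n by (simp add: power2_eq_square algebra_simps) (smt (verit) mult_nonneg_nonneg)
  qed (use n n' in auto)
  finally show ?thesis by simp
qed

text \<open>The excess is dominated by noise, a bound on the width, and \<open>\<theta> j\<close> on
  the event of a miss. In units of \<open>\<sigma>\<close> their means are at most 1,
  \<open>v + 2\<close> and 2, where \<open>v\<close> is the square root in the conclusion.\<close>

lemma expected_excess:
  assumes th: "\<theta> \<in> Theta_plus d s a" and a: "0 < a" and s: "1 \<le> s" and j: "j \<in> {1..d}"
    and w: "0 < w" "w \<le> a / \<sigma> - t" "t * gtail w \<le> 1"
  shows "(\<integral>X. \<theta> j - L X j \<partial>gauss d \<sigma> \<theta>) \<le> \<sigma> * (sqrt (2 * ln (4 * real s / \<beta>)) + 5)"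
proof (cases "\<theta> j = 0")
  case True
  have "(\<integral>X. \<theta> j - L X j \<partial>gauss d \<sigma> \<theta>) \<le> (\<integral>X. 0 \<partial>gauss d \<sigma> \<theta>)"
    by (rule integral_mono') (auto simp: True L_ad_def)
  also have "\<dots> \<le> \<sigma> * (sqrt (2 * ln (4 * real s / \<beta>)) + 5)"
    using sigma s beta by (auto intro!: mult_nonneg_nonneg add_nonneg_nonneg ln_ge_zero simp: le_divide_eq)
  finally show ?thesis .
next
  case False
  interpret M: prob_space "gauss d \<sigma> \<theta>" by (rule gauss_prob_space) (rule sigma)
  define J where "J = {j\<in>{1..d}. \<theta> j \<noteq> 0}"
  define B where "B = (\<lambda>i. {X\<in>Rd d. t \<le> (X i - \<theta> i) / \<sigma>})"
  \<comment> \<open>Exceedances are counted over all coordinates, so \<open>N\<close> bounds the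
    number of false positives and its mean is \<open>real d * gtail t\<close>.\<close>
  define N where "N = (\<lambda>X. \<Sum>i\<in>{1..d}. indicator (B i) X :: real)"
  define r where "r = \<theta> j / \<sigma> - t"
  define D where "D = {X\<in>Rd d. r \<le> (\<theta> j - X j) / \<sigma>}"
  define v where "v = sqrt (2 * ln (4 * real s / \<beta>))"
  define Z where "Z = (\<lambda>X::vec. \<bar>(X j - \<theta> j) / \<sigma>\<bar>)"
  define f where "f = (\<lambda>X. \<sigma> * Z X + \<sigma> * (v + 1 + N X) + \<theta> j * indicator D X)"
  have v0: "0 \<le> v"
    using s beta by (auto simp: v_def le_divide_eq intro!: ln_ge_zero)
  have thj: "a \<le> \<theta> j" and card_J: "card J \<le> s"
    using th j False by (auto simp: Theta_plus_def J_def nnz_def)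
  have rw: "w \<le> r"
    using w(2) divide_right_mono[OF thj, of \<sigma>] sigma by (simp add: r_def)
  have meas_X: "(\<lambda>X. X i) \<in> borel_measurable (gauss d \<sigma> \<theta>)" if "i \<in> {1..d}" for i
    using that by measurable
  have meas_B: "B i \<in> M.events" if "i \<in> {1..d}" for i
    using meas_X[OF that] unfolding B_def space_gauss[symmetric, of d \<sigma> \<theta>] by measurable
  have meas_D: "D \<in> M.events"
    using meas_X[OF j] unfolding D_def space_gauss[symmetric, of d \<sigma> \<theta>] by measurable
  have Z0: "0 \<le> Z X" for X by (simp add: Z_def)
  have Z: "integrable (gauss d \<sigma> \<theta>) Z" "(\<integral>X. Z X \<partial>gauss d \<sigma> \<theta>) \<le> 1"
    using gauss_abs_moment[OF sigma j, of \<theta>] by (simp_all only: Z_def)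
  have N0: "0 \<le> N X" for X by (simp add: N_def sum_nonneg)
  have pB: "measure (gauss d \<sigma> \<theta>) (B i) = gtail t" if "i \<in> {1..d}" for i
    unfolding B_def by (rule gauss_upper_tail[OF sigma that])
  have pD: "measure (gauss d \<sigma> \<theta>) D = gtail r"
    unfolding D_def by (rule gauss_lower_tail[OF sigma j])
  have int_ind: "integrable (gauss d \<sigma> \<theta>) (indicator E :: vec \<Rightarrow> real)" if "E \<in> M.events" for E
    using that by (simp add: M.emeasure_eq_measure)
  have int_N: "integrable (gauss d \<sigma> \<theta>) N"
    unfolding N_def using meas_B int_ind by (intro Bochner_Integration.integrable_sum) auto
  have EN: "(\<integral>X. N X \<partial>gauss d \<sigma> \<theta>) \<le> 1"
  proof -
    have "(\<integral>X. N X \<partial>gauss d \<sigma> \<theta>) = (\<Sum>i\<in>{1..d}. \<integral>X. indicator (B i) X \<partial>gauss d \<sigma> \<theta>)"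
      unfolding N_def using meas_B int_ind by (intro Bochner_Integration.integral_sum) auto
    also have "\<dots> = real d * gtail t"
      using meas_B pB by (simp add: sets.Int_space_eq2)
    also have "\<dots> \<le> 4 / 5 * \<beta>"
      using mult_left_mono[OF gtail_t_le, of "real d"] d by simp
    finally show ?thesis using beta by simp
  qed
  have int_f: "integrable (gauss d \<sigma> \<theta>) f"
    unfolding f_def
    by (intro Bochner_Integration.integrable_add integrable_mult_right Z(1) int_N M.integrable_const int_ind meas_D)
  have "(\<integral>X. \<theta> j - L X j \<partial>gauss d \<sigma> \<theta>) \<le> (\<integral>X. f X \<partial>gauss d \<sigma> \<theta>)"
  \<comment> \<open>Integrability is supplied for the majorant alone; since it is nonnegative, the
    inequality also covers an integral that defaults to 0.\<close>
  proof (rule integral_mono'[OF int_f])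
    fix X assume "X \<in> space (gauss d \<sigma> \<theta>)"
    then have X: "X \<in> Rd d" by (simp add: space_gauss)
    show f0: "0 \<le> f X"
      unfolding f_def using sigma v0 N0 Z0 thj a by (intro add_nonneg_nonneg mult_nonneg_nonneg) auto
    show "\<theta> j - L X j \<le> f X"
    proof (cases "j \<in> S X")
      case False
      then have "X j / \<sigma> < t" using j by (auto simp: mem_S)
      then have "X \<in> D" using X by (simp add: D_def r_def diff_divide_distrib)
      moreover have "0 \<le> \<sigma> * Z X + \<sigma> * (v + 1 + N X)"
        using sigma v0 N0 Z0 by (intro add_nonneg_nonneg mult_nonneg_nonneg) auto
      ultimately show ?thesis using False by (simp add: f_def L_ad_def)
    next
      case True
      have finS: "finite (S X)" by (rule finite_subset[of _ "{1..d}"]) (auto simp: mem_S)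
      \<comment> \<open>A selected coordinate lies in the support or is a false positive.\<close>
      have "S X \<subseteq> J \<union> {i\<in>{1..d}. X \<in> B i}"
        using X by (auto simp: mem_S J_def B_def)
      then have "card (S X) \<le> card (J \<union> {i\<in>{1..d}. X \<in> B i})"
        by (intro card_mono) (auto simp: J_def)
      also have "\<dots> \<le> s + card {i\<in>{1..d}. X \<in> B i}"
        using card_Un_le card_J by (meson add_le_mono1 le_trans)
      finally have "real (card (S X)) \<le> real s + real (card {i\<in>{1..d}. X \<in> B i})"
        by (simp only: flip: of_nat_add of_nat_le_iff[where 'a = real])
      also have "real (card {i\<in>{1..d}. X \<in> B i}) = N X"
        unfolding N_def by (simp add: indicator_def sum.If_cases Int_def)
      finally have "real (card (S X)) \<le> real s + N X" .
      moreover have "1 \<le> card (S X)"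
        using True finS by (simp add: Suc_le_eq card_gt_0_iff) auto
      ultimately have u: "u_ad \<alpha> \<alpha>' (shat X) \<le> v + 1 + N X"
        unfolding v_def using s N0 by (intro u_ad_shat_le) auto
      have "\<theta> j - L X j \<le> (\<theta> j - X j) + \<sigma> * u_ad \<alpha> \<alpha>' (shat X)"
        using True by (simp add: L_ad_def max_def mult.commute)
      also have "\<dots> \<le> \<sigma> * Z X + \<sigma> * (v + 1 + N X)"
        using sigma u by (intro add_mono mult_left_mono) (auto simp: Z_def abs_divide)
      also have "\<dots> \<le> f X"
        using thj a by (simp add: f_def)
      finally show ?thesis .
    qed
  qed
  also have "(\<integral>X. f X \<partial>gauss d \<sigma> \<theta>) =
      \<sigma> * (\<integral>X. Z X \<partial>gauss d \<sigma> \<theta>) + \<sigma> * (v + 1 + (\<integral>X. N X \<partial>gauss d \<sigma> \<theta>)) + \<theta> j * gtail r"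
    unfolding f_def
    using Z(1) int_N meas_D int_ind[OF meas_D] pD
    by (simp add: sets.Int_space_eq2 M.prob_space)
  also have "\<dots> \<le> \<sigma> * 1 + \<sigma> * (v + 1 + 1) + \<sigma> * 2"
  proof (intro add_mono mult_left_mono Z(2) EN)
    \<comment> \<open>Splitting \<open>\<theta> j\<close> at the threshold: Mills' inequality bounds
      the part \<open>r\<close> above it, and the hypothesis on \<open>w\<close> bounds the part
      \<open>t\<close>, because \<open>r \<ge> w\<close>.\<close>
    have "\<theta> j * gtail r = \<sigma> * (r * gtail r + t * gtail r)"
      using sigma by (simp add: r_def algebra_simps)
    also have "\<dots> \<le> \<sigma> * (1 + 1)"
    proof (intro mult_left_mono add_mono)
      show "r * gtail r \<le> 1" using rw w(1) by (intro mult_gtail_le_1) simp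
      have "t * gtail r \<le> t * gtail w"
        using t_nonneg rw by (intro mult_left_mono gtail_antimono)
      then show "t * gtail r \<le> 1" using w(3) by linarith
    qed (use sigma in simp)
    finally show "\<theta> j * gtail r \<le> \<sigma> * 2" by simp
  qed (use sigma in auto)
  also have "\<dots> = \<sigma> * (v + 5)" by (simp add: algebra_simps)
  finally show ?thesis by (simp add: v_def)
qed

text \<open>The first root of \<open>signal_bound\<close> dominates \<open>t\<close>, so the maximum
  of the other two terms is a valid margin \<open>w\<close>. Its first entry makes misses rare
  enough for coverage, its second makes them cheap enough for the risk. The constant
  \<open>C'\<close> absorbs the passage from \<open>d / \<beta>\<close> to \<open>d - s\<close> and
  the level \<open>\<alpha>'\<close>.\<close>

lemma signal_margin:
  assumes sd: "2 * s \<le> d" and s: "3 \<le> s" and a': "0 < \<alpha>'" "\<alpha>' < 1"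
    and C: "2 * ln 2 + 2 * ln (1 / \<beta>) + 2 * ln (1 / \<alpha>') \<le> C'"
    and signal: "signal_bound C' d s \<le> a / \<sigma>"
    and d_large: "sqrt (2 * ln (real d / \<beta>)) \<le> ln (real d / 2)"
  obtains w where "0 < w" "w \<le> a / \<sigma> - t" "real s * gtail w \<le> \<alpha>'" "t * gtail w \<le> 1"
proof -
  have ln_ge_1: "1 < ln x" if "3 \<le> x" for x :: real
  proof -
    have "exp 1 < x" using e_less_272 that by simp
    then show ?thesis using that ln_less_cancel_iff[of "exp 1" x] by simp
  qed
  have ls: "1 < ln (real s)" using s by (intro ln_ge_1) simp
  have dd: "real d / 2 \<le> real d - real s" "real d - real s \<le> real d" "3 \<le> real d - real s" "3 \<le> real d / 2"
    using sd s by (auto simp: field_simps)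
  have lds: "1 < ln (real d - real s)" using dd by (intro ln_ge_1) simp
  have b: "0 \<le> ln (1 / \<beta>)" and a0: "0 \<le> ln (1 / \<alpha>')" using beta a' by auto
  define q where "q = 2 * ln (real s) - ln (ln (real s)) + C'"
  define w where "w = max (sqrt q) (xi_bar d s)"
  have C2: "2 * ln (1 / \<alpha>') \<le> C'" "2 * ln 2 + 2 * ln (1 / \<beta>) \<le> C'" "0 \<le> C'"
    using C a0 b ln_gt_zero[of 2] by linarith+
  have q: "ln (real s) \<le> q"
    using ln_le_minus_one[of "ln (real s)"] ls C2 unfolding q_def by linarith
  have sq: "0 < sqrt (ln (real s))" "sqrt (ln (real s)) \<le> sqrt q" "sqrt q \<le> w"
    using ls q by (auto simp: w_def)
  have exp_half: "exp (- x / 2) \<le> y" if "0 < y" "2 * ln (1 / y) \<le> x" for x y :: real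
  proof -
    have "- x / 2 \<le> ln y" using that by (simp add: ln_div)
    then show ?thesis using that by (simp add: ln_ge_iff)
  qed
  \<comment> \<open>Mills' inequality gains the factor \<open>1 / sqrt (ln s)\<close>, which
    compensates the term \<open>- ln (ln s)\<close> in both \<open>q\<close> and
    \<open>xi_bar\<close>.\<close>
  have gtail_exp: "gtail c \<le> y / sqrt (ln (real s))"
    if "sqrt (ln (real s)) \<le> c" "exp (- c\<^sup>2 / 2) \<le> y" for c y
  proof -
    have c: "0 < c" using that sq by linarith
    have "gtail c \<le> std_normal_density c / c" by (rule gtail_le_mills[OF c])
    also have "\<dots> \<le> y / sqrt (ln (real s))"
    proof (rule frac_le)
      have "1 \<le> sqrt (2 * pi)" using pi_gt3 by (simp add: real_le_rsqrt)
      then have "std_normal_density c \<le> exp (- c\<^sup>2 / 2)"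
        by (simp add: std_normal_density_def divide_le_eq mult_le_cancel_right1)
      then show "std_normal_density c \<le> y" using that(2) by linarith
      show "0 \<le> y" using that(2) exp_ge_zero order_trans by blast
    qed (use that sq in auto)
    finally show ?thesis .
  qed
  have "t \<le> sqrt (2 * ln (real d - real s) - ln (ln (real d - real s)) + C')"
  proof -
    have d0: "0 < real d" using d by simp
    have ld: "0 < ln (real d)" using lds dd ln_mono[of "real d - real s" "real d"] by linarith
    have eq: "ln (real d / \<beta>) = ln (real d) + ln (1 / \<beta>)"
      using d0 beta by (simp add: ln_div)
    have "ln (real d) \<le> ln (real d / \<beta>)" using eq b by simp
    also have "\<dots> \<le> pi * ln (real d / \<beta>)"
      using calculation ld pi_ge_two by (simp add: mult_le_cancel_right1)
    finally have 1: "ln (ln (real d)) \<le> ln (pi * ln (real d / \<beta>))"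
      using ld by (intro ln_mono) auto
    have 2: "ln (ln (real d - real s)) \<le> ln (ln (real d))"
      using lds dd by (intro ln_mono) auto
    \<comment> \<open>Since \<open>d - s \<ge> d / 2\<close>, replacing \<open>d\<close> by
      \<open>d - s\<close> costs \<open>2 * ln 2\<close> in the radicand.\<close>
    have 3: "ln (real d) - ln 2 \<le> ln (real d - real s)"
      using ln_mono[OF dd(1)] d0 by (simp add: ln_div)
    from 1 2 3 C2(2) show ?thesis
      unfolding thr_def eq by (intro real_sqrt_le_mono) argo
  qed
  then have margin: "w \<le> a / \<sigma> - t"
    using signal unfolding signal_bound_def w_def q_def by linarith
  have "exp (- q / 2) \<le> sqrt (ln (real s)) / real s * \<alpha>'"
  proof (rule exp_half)
    have "ln (1 / (sqrt (ln (real s)) / real s * \<alpha>')) = ln (real s) - ln (ln (real s)) / 2 + ln (1 / \<alpha>')"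
      using ls s a' by (simp add: ln_div ln_mult ln_sqrt)
    then show "2 * ln (1 / (sqrt (ln (real s)) / real s * \<alpha>')) \<le> q"
      using C2(1) unfolding q_def by linarith
  qed (use ls s a' in simp)
  then have "gtail (sqrt q) \<le> sqrt (ln (real s)) / real s * \<alpha>' / sqrt (ln (real s))"
    using sq q ls by (intro gtail_exp) auto
  also have "\<dots> = \<alpha>' / real s" using sq(1) by simp
  finally have "gtail w \<le> \<alpha>' / real s"
    using gtail_antimono[OF sq(3)] by linarith
  then have miss: "real s * gtail w \<le> \<alpha>'"
    using s by (simp add: field_simps)
  have "gtail w \<le> sqrt (ln (real s)) / ln (real d - real s) / sqrt (ln (real s))"
  proof (rule gtail_exp)
    have "2 * ln (1 / (sqrt (ln (real s)) / ln (real d - real s)))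
        = 2 * ln (ln (real d - real s)) - ln (ln (real s))"
      using ls lds by (simp add: ln_div ln_sqrt)
    also have "\<dots> \<le> (xi_bar d s)\<^sup>2"
      unfolding xi_bar_def by simp
    also have "\<dots> \<le> w\<^sup>2"
      by (intro power_mono) (auto simp: w_def xi_bar_def)
    finally show "exp (- w\<^sup>2 / 2) \<le> sqrt (ln (real s)) / ln (real d - real s)"
      using ls lds by (intro exp_half) auto
  qed (use sq in linarith)
  also have "\<dots> = 1 / ln (real d - real s)" using sq(1) by simp
  finally have gw: "gtail w \<le> 1 / ln (real d - real s)" .
  \<comment> \<open>The threshold is of order \<open>sqrt (ln d)\<close>, so the decay
    \<open>1 / ln (d - s)\<close> of \<open>gtail w\<close> outweighs it.\<close>
  have "t \<le> sqrt (2 * ln (real d / \<beta>))"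
    using dd beta by (intro thr_le) (simp add: le_divide_eq)
  also have "\<dots> \<le> ln (real d / 2)" by (rule d_large)
  also have "\<dots> \<le> ln (real d - real s)" using dd by (intro ln_mono) auto
  finally have "t * gtail w \<le> ln (real d - real s) * (1 / ln (real d - real s))"
    using gw t_nonneg gtail_nonneg lds by (intro mult_mono) auto
  then have "t * gtail w \<le> 1" using lds by simp
  moreover have "0 < w" using sq by linarith
  ultimately show thesis using margin miss by (intro that)
qed

end

subsection \<open>The asymptotic regime\<close>

lemma eventually_regime_fst:
  assumes "eventually P at_top"
  shows "\<forall>\<^sub>F (d, s) in regime. P d"
proof -
  have "filterlim fst at_top (at_top \<times>\<^sub>F at_top :: (nat \<times> nat) filter)" by (rule filterlim_fst)
  then show ?thesis
    using assms unfolding regime_def case_prod_unfold filterlim_iff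
    by (auto simp: eventually_inf_principal elim: eventually_mono)
qed

lemma filterlim_snd_regime: "filterlim snd at_top regime"
  unfolding regime_def
  by (rule filterlim_mono[OF filterlim_snd order_refl inf_le1])

lemma eventually_regime_le: "\<forall>\<^sub>F (d, s) in regime. 2 * s \<le> d"
  unfolding regime_def by (auto simp: eventually_inf_principal)

text \<open>For the trivial filter the upper limit is \<open>-\<infinity>\<close>; otherwise the
  limit of \<open>g\<close> is its upper limit.\<close>

lemma Limsup_le_of_tendsto:
  fixes f :: "'a \<Rightarrow> ereal"
  assumes "\<forall>\<^sub>F x in F. f x \<le> g x" "(g \<longlongrightarrow> l) F"
  shows "Limsup F f \<le> l"
proof (cases "F = bot")
  case False
  have "Limsup F f \<le> Limsup F g" by (rule Limsup_mono) (rule assms(1))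
  also have "\<dots> = l" using lim_imp_Limsup[OF False assms(2)] .
  finally show ?thesis .
qed simp

theorem theorem4p1:
  fixes \<alpha> \<delta> \<gamma> \<alpha>' :: real
  assumes "0 < \<alpha>" "\<alpha> < 1" and "0 < \<delta>" "\<delta> < 1" and "0 < \<gamma>" "\<gamma> < 1" and "\<alpha>' = \<gamma> * \<alpha>"
  shows "\<exists>C\<^sub>0>0. \<forall>C'\<ge>C\<^sub>0. \<forall>\<sigma> a :: nat \<Rightarrow> nat \<Rightarrow> real.
    (\<forall>d s. \<sigma> d s > 0 \<and> a d s > 0) \<longrightarrow>
    (\<forall>\<^sub>F (d, s) in regime. a d s / \<sigma> d s \<ge> signal_bound C' d s) \<longrightarrow>
    (\<lambda>d s. S_ad \<alpha> \<alpha>' d (\<sigma> d s), \<lambda>d s. U_ad \<alpha> \<alpha>' d (\<sigma> d s), \<lambda>d s. L_ad \<alpha> \<alpha>' d (\<sigma> d s))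
      \<in> M_plus_tuned \<alpha> \<delta> \<sigma> a (\<lambda>d s. s_hat \<alpha> \<alpha>' d (\<sigma> d s)) \<and>
    Limsup regime (\<lambda>(d, s). risk d (\<sigma> d s) (L_ad \<alpha> \<alpha>' d (\<sigma> d s)) (Theta_plus d s (a d s))
                              / ereal (\<sigma> d s * sqrt (2 * ln (real s)))) \<le> 1"
proof -
  define \<beta> where "\<beta> = \<alpha> - \<alpha>'"
  \<comment> \<open>The least constant that \<open>signal_margin\<close> accepts; it depends only on
    \<open>\<alpha>\<close> and \<open>\<gamma>\<close>.\<close>
  define C\<^sub>0 where "C\<^sub>0 = 2 * ln 2 + 2 * ln (1 / \<beta>) + 2 * ln (1 / \<alpha>')"
  have a': "0 < \<alpha>'" "\<alpha>' < \<alpha>" using assms by simp_all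
  then have b: "0 < \<beta>" "\<beta> < 1" and a'1: "\<alpha>' < 1"
    using assms(2) unfolding \<beta>_def by linarith+
  have C0: "0 < C\<^sub>0"
    unfolding C\<^sub>0_def using b a' a'1 by (intro add_pos_nonneg) auto
  \<comment> \<open>Everything asked of \<open>(d, s)\<close> apart from the signal condition. Only
    the last clause involves \<open>\<delta>\<close>.\<close>
  define good where "good = (\<lambda>(d::nat) s::nat. 2 * s \<le> d \<and> 3 \<le> s \<and> 1 \<le> d
    \<and> sqrt (2 * ln (real d / \<beta>)) \<le> ln (real d / 2)
    \<and> real d * gtail (thr (real d / \<beta>)) \<le> 3 / 5 * \<beta> \<and> gtail (thr (real d / \<beta>)) \<le> 1 - \<delta>)"
  have ev_good: "\<forall>\<^sub>F (d, s) in regime. good d s"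
  proof -
    have lim: "filterlim (\<lambda>d. real d / \<beta>) at_top at_top"
      using b by real_asymp
    \<comment> \<open>One tail bound serves twice: multiplied by \<open>d\<close> it limits false
      positives, and since it tends to 0 it falls below \<open>1 - \<delta>\<close>.\<close>
    have "\<forall>\<^sub>F d in at_top. gtail (thr (real d / \<beta>)) \<le> 3 / 5 / (real d / \<beta>)"
      using eventually_compose_filterlim[OF eventually_gtail_thr_le lim] .
    moreover have "\<forall>\<^sub>F d in at_top. 3 / 5 / (real d / \<beta>) \<le> 1 - \<delta>"
      using b assms(4) by real_asymp
    moreover have "\<forall>\<^sub>F d in at_top. sqrt (2 * ln (real d / \<beta>)) \<le> ln (real d / 2)"
      using b by real_asymp
    moreover have "\<forall>\<^sub>F d::nat in at_top. 1 \<le> d"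
      by (rule eventually_ge_at_top)
    ultimately have "\<forall>\<^sub>F d::nat in at_top. 1 \<le> d \<and> sqrt (2 * ln (real d / \<beta>)) \<le> ln (real d / 2)
        \<and> real d * gtail (thr (real d / \<beta>)) \<le> 3 / 5 * \<beta> \<and> gtail (thr (real d / \<beta>)) \<le> 1 - \<delta>"
    proof eventually_elim
      case (elim d)
      moreover from elim have "gtail (thr (real d / \<beta>)) \<le> 1 - \<delta>"
        by linarith
      ultimately show ?case by (auto simp: field_simps)
    qed
    from eventually_regime_fst[OF this] eventually_regime_le
      eventually_compose_filterlim[OF eventually_ge_at_top filterlim_snd_regime, of 3]
    show ?thesis
      by eventually_elim (auto simp: good_def)
  qed
  show ?thesis
  proof (intro exI[of _ C\<^sub>0] conjI allI impI C0)
    fix C' and \<sigma> a :: "nat \<Rightarrow> nat \<Rightarrow> real"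
    assume C': "C\<^sub>0 \<le> C'" and pos: "\<forall>d s. \<sigma> d s > 0 \<and> a d s > 0"
      and signal: "\<forall>\<^sub>F (d, s) in regime. a d s / \<sigma> d s \<ge> signal_bound C' d s"
    have adaptive: "adaptive_set \<alpha> \<alpha>' \<beta> (\<sigma> d s) d" if "good d s" for d s
      using that pos b by unfold_locales (auto simp: good_def \<beta>_def)
    define R where "R = (\<lambda>(d, s). risk d (\<sigma> d s) (L_ad \<alpha> \<alpha>' d (\<sigma> d s)) (Theta_plus d s (a d s))
                              / ereal (\<sigma> d s * sqrt (2 * ln (real s))))"
    \<comment> \<open>The bound of \<open>expected_excess\<close> after normalisation;
      \<open>4 / \<beta>\<close> and 5 are of lower order, so it tends to 1.\<close>
    define g where "g = (\<lambda>s. (sqrt (2 * ln (4 * real s / \<beta>)) + 5) / sqrt (2 * ln (real s)))"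
    have cov_risk: "(INF \<theta>\<in>Theta_plus d s (a d s). ereal (measure (gauss d (\<sigma> d s) \<theta>)
          {X\<in>Rd d. \<theta> \<in> conf_set d (S_ad \<alpha> \<alpha>' d (\<sigma> d s)) (U_ad \<alpha> \<alpha>' d (\<sigma> d s)) (L_ad \<alpha> \<alpha>' d (\<sigma> d s)) X}))
        \<ge> ereal (1 - \<alpha>) \<and> R (d, s) \<le> ereal (g s)"
      if gd: "good d s" and sig: "signal_bound C' d s \<le> a d s / \<sigma> d s" for d s
    proof
      interpret adaptive_set \<alpha> \<alpha>' \<beta> "\<sigma> d s" d by (rule adaptive[OF gd])
      have ads: "0 < a d s" using pos by simp
      obtain w where w: "0 < w" "w \<le> a d s / \<sigma> d s - t" "real s * gtail w \<le> \<alpha>'" "t * gtail w \<le> 1"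
        using gd a'(1) a'1 C' sig unfolding good_def C\<^sub>0_def by (elim conjE signal_margin)
      have miss: "real s * gtail (a d s / \<sigma> d s - t) \<le> \<alpha>'"
        using mult_left_mono[OF gtail_antimono[OF w(2)], of "real s"] w(3) by simp
      show "ereal (1 - \<alpha>) \<le> (INF \<theta>\<in>Theta_plus d s (a d s). ereal (measure (gauss d (\<sigma> d s) \<theta>)
          {X\<in>Rd d. \<theta> \<in> conf_set d S U L X}))"
        using gd ads miss by (intro INF_greatest) (auto simp: good_def intro!: coverage)
      have ls: "0 < ln (real s)" using gd by (auto simp: good_def)
      have "risk d (\<sigma> d s) L (Theta_plus d s (a d s))
          \<le> ereal (\<sigma> d s * (sqrt (2 * ln (4 * real s / \<beta>)) + 5))"
        unfolding risk_def using gd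
        by (intro SUP_least) (auto simp: good_def intro!: expected_excess[OF _ ads _ _ w(1,2,4)])
      then have "R (d, s) \<le> ereal (\<sigma> d s * (sqrt (2 * ln (4 * real s / \<beta>)) + 5))
          / ereal (\<sigma> d s * sqrt (2 * ln (real s)))"
        unfolding R_def prod.case using sigma ls
        by (intro ereal_divide_right_mono) auto
      also have "\<dots> = ereal (g s)"
        using sigma ls by (simp add: g_def)
      finally show "R (d, s) \<le> ereal (g s)" .
    qed
    have ev: "\<forall>\<^sub>F (d, s) in regime. good d s \<and> signal_bound C' d s \<le> a d s / \<sigma> d s"
      using ev_good signal by eventually_elim auto
    show "(\<lambda>d s. S_ad \<alpha> \<alpha>' d (\<sigma> d s), \<lambda>d s. U_ad \<alpha> \<alpha>' d (\<sigma> d s), \<lambda>d s. L_ad \<alpha> \<alpha>' d (\<sigma> d s))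
      \<in> M_plus_tuned \<alpha> \<delta> \<sigma> a (\<lambda>d s. s_hat \<alpha> \<alpha>' d (\<sigma> d s))"
      unfolding M_plus_tuned_def mem_Collect_eq prod.case
    proof (intro conjI Liminf_bounded)
      show "\<forall>\<^sub>F (d, s) in regime. (S_ad \<alpha> \<alpha>' d (\<sigma> d s), U_ad \<alpha> \<alpha>' d (\<sigma> d s), L_ad \<alpha> \<alpha>' d (\<sigma> d s))
          \<in> CI_plus_tuned d (s_hat \<alpha> \<alpha>' d (\<sigma> d s))"
        using ev_good
        by eventually_elim (auto dest!: adaptive intro: adaptive_set.mem_CI_plus_tuned)
      show "\<forall>\<^sub>F (d, s) in regime. S_ad \<alpha> \<alpha>' d (\<sigma> d s) \<in> selectors d (\<sigma> d s) \<delta>"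
        using ev_good
        by eventually_elim (auto intro!: adaptive_set.S_in_selectors[OF adaptive] simp: good_def)
    qed (use ev cov_risk in \<open>auto elim!: eventually_mono\<close>)
    have "((\<lambda>s. ereal (g s)) \<longlongrightarrow> 1) at_top"
      unfolding g_def one_ereal_def lim_ereal using b by real_asymp
    from filterlim_compose[OF this filterlim_snd_regime]
    have "((\<lambda>x. ereal (g (snd x))) \<longlongrightarrow> 1) regime" .
    moreover have "\<forall>\<^sub>F x in regime. R x \<le> ereal (g (snd x))"
      using ev by eventually_elim (auto dest: cov_risk)
    ultimately show "Limsup regime (\<lambda>(d, s). risk d (\<sigma> d s) (L_ad \<alpha> \<alpha>' d (\<sigma> d s)) (Theta_plus d s (a d s))
                              / ereal (\<sigma> d s * sqrt (2 * ln (real s)))) \<le> 1"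
      unfolding R_def[symmetric] by (intro Limsup_le_of_tendsto)
  qed
qed

end
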